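(* Let $G$ be a compact Hausdorff Abelian group, let $G^\wedge$ be its dual group with counting measure $\nu$, let $p$ be a continuous invariant pseudo-metric on $G^\wedge$, and let $\gamma(\xi):=p(\xi,1)$ for $\xi\in G^\wedge$. Suppose that for each $d>0$ the set $\{\xi\in G^\wedge:\gamma(\xi)\le d\}$ is finite. Then the operator $T:L^2(G^\wedge)\to L^2(G^\wedge)$ defined by $$[T(f)](\xi):=\frac{f(\xi)}{\sqrt{1+\gamma(\xi)^2}},\qquad \xi\in G^\wedge,$$ is compact.
   Context: $G^\wedge$ is the group of continuous homomorphisms $\xi:G\to\mathbb{S}^1$ with identity element $1$ (discrete since $G$ is compact). A pseudo-metric $p$ on $G^\wedge$ is invariant if it is invariant under translations of the group. $L^2(G^\wedge)$ is taken with respect to the counting measure $\nu$. *)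

theory Defs
  imports "HOL-Analysis.Analysis"
begin

section \<open>The dual group\<close>

text \<open>The group is written additively, its dual multiplicatively; the circle is the unit
  circle in the complex plane.\<close>

typedef (overloaded) ('a :: topological_ab_group_add) dual =
  "{\<xi> :: 'a \<Rightarrow> complex. continuous_on UNIV \<xi> \<and> (\<forall>x. \<xi> x \<in> sphere 0 1) \<and>
      (\<forall>x y. \<xi> (x + y) = \<xi> x * \<xi> y)}"
  morphisms character Abs_dual
  by (intro exI[of _ "\<lambda>_. 1"]) simp

setup_lifting type_definition_dual

instantiation dual :: (topological_ab_group_add) comm_monoid_mult
begin

lift_definition one_dual :: "'a dual" is "\<lambda>_. 1"
  by simp

lift_definition times_dual :: "'a dual \<Rightarrow> 'a dual \<Rightarrow> 'a dual" is "\<lambda>\<xi> \<eta> x. \<xi> x * \<eta> x"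
  by (auto intro!: continuous_intros simp: norm_mult)

instance
  by standard (transfer, simp add: ac_simps)+

end

text \<open>HOL has no type class of multiplicative abelian groups; inverses exist by the following.\<close>

lemma dual_left_inverse: "\<exists>\<eta>. \<eta> * \<xi> = 1" for \<xi> :: "'a :: topological_ab_group_add dual"
  by transfer
    (rule_tac x = "\<lambda>x. cnj (\<xi> x)" in bexI,
      auto intro!: continuous_intros simp: complex_norm_square[symmetric] mult.commute)

text \<open>The compact-open topology, which is discrete when the group is compact.\<close>

instantiation dual :: (topological_ab_group_add) topological_space
begin

definition open_dual :: "'a dual set \<Rightarrow> bool" where
  "open_dual = generate_topology
     {{\<xi>. character \<xi> ` K \<subseteq> U} | K U. compact K \<and> open U}"

instance
  by standard (auto simp: open_dual_def intro: generate_topology.intros)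

end


section \<open>Invariant pseudo-metrics\<close>

definition pseudometric :: "('a \<Rightarrow> 'a \<Rightarrow> real) \<Rightarrow> bool" where
  "pseudometric p \<longleftrightarrow>
     (\<forall>x y. 0 \<le> p x y) \<and> (\<forall>x. p x x = 0) \<and> (\<forall>x y. p x y = p y x) \<and>
     (\<forall>x y z. p x z \<le> p x y + p y z)"

definition translation_invariant :: "('a :: comm_monoid_mult \<Rightarrow> 'a \<Rightarrow> real) \<Rightarrow> bool" where
  "translation_invariant p \<longleftrightarrow> (\<forall>x y z. p (z * x) (z * y) = p x y)"


section \<open>The space $L^2$ of the counting measure\<close>

text \<open>Every function is measurable for the counting measure and only the empty set is null,
  so no quotient by almost everywhere equality is needed.\<close>

typedef 'a l2 =
  "{f :: 'a \<Rightarrow> complex. integrable (count_space UNIV) (\<lambda>x. (cmod (f x))\<^sup>2)}"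
  morphisms l2_apply Abs_l2
  by (intro exI[of _ "\<lambda>_. 0"]) simp

setup_lifting type_definition_l2

lemma square_add_le:
  fixes a b t :: real
  assumes "0 < t" "t < 1"
  shows "(a + b)\<^sup>2 \<le> a\<^sup>2 / t + b\<^sup>2 / (1 - t)"
proof -
  have "a\<^sup>2 / t + b\<^sup>2 / (1 - t) - (a + b)\<^sup>2 = ((1 - t) * a - t * b)\<^sup>2 / (t * (1 - t))"
    using assms by (simp add: field_simps power2_eq_square)
  moreover have "\<dots> \<ge> 0"
    using assms by simp
  ultimately show ?thesis
    by linarith
qed

lemma norm_square_add_le:
  fixes u v :: complex and t :: real
  assumes "0 < t" "t < 1"
  shows "(cmod (u + v))\<^sup>2 \<le> (cmod u)\<^sup>2 / t + (cmod v)\<^sup>2 / (1 - t)"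
  by (rule order_trans[OF power_mono[OF norm_triangle_ineq norm_ge_zero] square_add_le[OF assms]])

lemma l2_mono:
  assumes "integrable (count_space UNIV) g" "\<And>x. (cmod (f x))\<^sup>2 \<le> g x"
  shows "integrable (count_space UNIV) (\<lambda>x. (cmod (f x))\<^sup>2)"
  using assms by (intro Bochner_Integration.integrable_bound[OF assms(1)]) (auto intro: order_trans[OF _ abs_ge_self])

lemma l2_add:
  assumes "integrable (count_space UNIV) (\<lambda>x. (cmod (f x))\<^sup>2)"
    and "integrable (count_space UNIV) (\<lambda>x. (cmod (g x))\<^sup>2)"
  shows "integrable (count_space UNIV) (\<lambda>x. (cmod (f x + g x))\<^sup>2)"
  by (rule l2_mono[where g = "\<lambda>x. (cmod (f x))\<^sup>2 / (1/2) + (cmod (g x))\<^sup>2 / (1 - 1/2)"])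
     (use assms in simp, rule norm_square_add_le, auto)

lift_definition scaleC_l2 :: "complex \<Rightarrow> 'a l2 \<Rightarrow> 'a l2" is "\<lambda>c f x. c * f x"
  by (simp add: norm_mult power_mult_distrib)

instantiation l2 :: (type) real_normed_vector
begin

lift_definition zero_l2 :: "'a l2" is "\<lambda>_. 0"
  by simp

lift_definition plus_l2 :: "'a l2 \<Rightarrow> 'a l2 \<Rightarrow> 'a l2" is "\<lambda>f g x. f x + g x"
  by (rule l2_add)

lift_definition uminus_l2 :: "'a l2 \<Rightarrow> 'a l2" is "\<lambda>f x. - f x"
  by simp

lift_definition minus_l2 :: "'a l2 \<Rightarrow> 'a l2 \<Rightarrow> 'a l2" is "\<lambda>f g x. f x - g x"
  using l2_add[of _ "\<lambda>x. - _ x"] by simp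

lift_definition scaleR_l2 :: "real \<Rightarrow> 'a l2 \<Rightarrow> 'a l2" is "\<lambda>r f x. complex_of_real r * f x"
  by (simp add: norm_mult power_mult_distrib)

lift_definition norm_l2 :: "'a l2 \<Rightarrow> real" is
  "\<lambda>f. sqrt (\<integral>x. (cmod (f x))\<^sup>2 \<partial>count_space UNIV)" .

definition sgn_l2 :: "'a l2 \<Rightarrow> 'a l2" where
  "sgn_l2 f = scaleR (inverse (norm f)) f"

definition dist_l2 :: "'a l2 \<Rightarrow> 'a l2 \<Rightarrow> real" where
  "dist_l2 f g = norm (f - g)"

definition uniformity_l2 :: "('a l2 \<times> 'a l2) filter" where
  "uniformity_l2 = (INF e\<in>{0<..}. principal {(f, g). dist f g < e})"

definition open_l2 :: "'a l2 set \<Rightarrow> bool" where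
  "open_l2 U \<longleftrightarrow> (\<forall>f\<in>U. \<forall>\<^sub>F (f', g) in uniformity. f' = f \<longrightarrow> g \<in> U)"

instance
proof
  show eq0: "norm f = 0 \<longleftrightarrow> f = 0" for f :: "'a l2"
    by transfer
      (auto simp: integral_nonneg_eq_0_iff_AE AE_count_space fun_eq_iff)
  show "norm (scaleR r f) = \<bar>r\<bar> * norm f" for r and f :: "'a l2"
    by transfer (simp add: norm_mult power_mult_distrib real_sqrt_mult)
  have norm_sq: "(norm f)\<^sup>2 = (\<integral>x. (cmod (l2_apply f x))\<^sup>2 \<partial>count_space UNIV)" for f :: "'a l2"
    by transfer (simp add: integral_nonneg)
  have nonneg: "0 \<le> norm f" for f :: "'a l2"
    by transfer (simp add: integral_nonneg)
  show "norm (f + g) \<le> norm f + norm g" for f g :: "'a l2"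
  proof (cases "f = 0 \<or> g = 0")
    case True
    moreover have "0 + h = h" "h + 0 = h" for h :: "'a l2"
      by (transfer, simp)+
    ultimately show ?thesis
      using nonneg by auto
  next
    case False
    define a b t where "a = norm f" and "b = norm g" and "t = a / (a + b)"
    have ab: "0 < a" "0 < b"
      using False nonneg[of f] nonneg[of g] by (auto simp: a_def b_def eq0 less_le)
    then have t: "0 < t" "t < 1" "1 - t = b / (a + b)"
      by (auto simp: t_def field_simps)
    have int: "integrable (count_space UNIV) (\<lambda>x. (cmod (l2_apply h x))\<^sup>2)" for h :: "'a l2"
      using l2_apply by blast
    have "(norm (f + g))\<^sup>2 \<le>
        (\<integral>x. (cmod (l2_apply f x))\<^sup>2 / t + (cmod (l2_apply g x))\<^sup>2 / (1 - t) \<partial>count_space UNIV)"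
      unfolding norm_sq
      by (intro integral_mono int Bochner_Integration.integrable_add integrable_divide)
         (simp_all only: plus_l2.rep_eq norm_square_add_le t(1,2))
    also have "\<dots> = a\<^sup>2 / t + b\<^sup>2 / (1 - t)"
      by (simp add: int a_def b_def norm_sq)
    also have "\<dots> = (a + b)\<^sup>2"
      unfolding t(3) unfolding t_def using ab by (simp add: field_simps power2_eq_square)
    finally show ?thesis
      using ab by (auto simp: a_def b_def intro: power2_le_imp_le)
  qed
qed (fact sgn_l2_def dist_l2_def uniformity_l2_def open_l2_def
      | (transfer, simp add: algebra_simps))+

end


section \<open>Compact operators and the multiplier\<close>

text \<open>\<open>bounded_linear\<close> is linearity over the reals, so homogeneity over the complex numbers is
  required separately.\<close>

definition compact_operator :: "('a l2 \<Rightarrow> 'b l2) \<Rightarrow> bool" where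
  "compact_operator T \<longleftrightarrow>
     bounded_linear T \<and> (\<forall>c f. T (scaleC_l2 c f) = scaleC_l2 c (T f)) \<and>
     (\<forall>S. bounded S \<longrightarrow> compact (closure (T ` S)))"

lift_definition multiplier_operator :: "('a \<Rightarrow> real) \<Rightarrow> 'a l2 \<Rightarrow> 'a l2" is
  "\<lambda>\<gamma> f \<xi>. f \<xi> / complex_of_real (sqrt (1 + (\<gamma> \<xi>)\<^sup>2))"
proof (rule l2_mono)
  fix \<gamma> :: "'a \<Rightarrow> real" and f :: "'a \<Rightarrow> complex" and \<xi>
  have "cmod (f \<xi>) / sqrt (1 + (\<gamma> \<xi>)\<^sup>2) \<le> cmod (f \<xi>) / 1"
    by (intro divide_left_mono) (auto intro: add_pos_nonneg)
  then show "(cmod (f \<xi> / complex_of_real (sqrt (1 + (\<gamma> \<xi>)\<^sup>2))))\<^sup>2 \<le> (cmod (f \<xi>))\<^sup>2"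
    by (intro power_mono) (auto simp: norm_divide)
qed

end

theory Submission
  imports Defs
begin

text \<open>
  The multiplier sends a function of norm at most \<open>R\<close> to a point of the weighted ellipsoid
  \<open>{g. (\<Sum>\<xi>. w \<xi> * |g \<xi>|\<^sup>2) \<le> R\<^sup>2}\<close> with weight \<open>w = 1 + \<gamma>\<^sup>2\<close>, whose sublevel sets
  are finite by hypothesis. Such an ellipsoid is compact in the norm of \<open>L\<^sup>2\<close>
  (\<open>compact_l2_ellipsoid\<close>), and this is the whole content of the theorem: the closure of
  the image of a bounded set is then a closed subset of a compact set.

  For the compactness of the ellipsoid, regard it first as a set of plain functions with the product
  topology. It is cut out by the conditions \<open>(\<Sum>\<xi>\<in>F. w \<xi> * |g \<xi>|\<^sup>2) \<le> R\<^sup>2\<close> for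
  finite \<open>F\<close>, each of which is closed because it involves finitely many coordinates, and it
  lies in a product of discs; so it is compact by Tychonoff's theorem. The inclusion of this set into
  \<open>L\<^sup>2\<close> is continuous: where \<open>w > c\<close>, the weight bound makes the square sum of
  a difference at most \<open>4 R\<^sup>2 / c\<close> (\<open>sum_norm_square_diff_le\<close>), while only finitely many
  coordinates have \<open>w \<le> c\<close>. Hence pointwise convergence inside the ellipsoid is norm
  convergence.
\<close>

section \<open>Integrals over the counting measure and finite sums\<close>

lemma integrable_count_space_if_finite_sums_le:
  fixes f :: "'a \<Rightarrow> real"
  assumes nonneg: "\<And>x. 0 \<le> f x"
    and le: "\<And>F. finite F \<Longrightarrow> sum f F \<le> b"
  shows "integrable (count_space UNIV) f" and "integral\<^sup>L (count_space UNIV) f \<le> b"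
proof -
  have *: "f summable_on UNIV"
    by (rule nonneg_bdd_above_summable_on) (use assms in \<open>auto simp: bdd_above_def\<close>)
  then have abs: "Infinite_Set_Sum.abs_summable_on f UNIV"
    using nonneg by (simp flip: abs_summable_equivalent)
  then show "integrable (count_space UNIV) f"
    by (simp add: Infinite_Set_Sum.abs_summable_on_def)
  have "infsum f UNIV \<le> b"
    by (rule infsum_le_finite_sums[OF * le])
  then show "integral\<^sup>L (count_space UNIV) f \<le> b"
    using infsetsum_infsum[OF abs] by (simp add: infsetsum_def)
qed

lemma norm_l2_square_le_iff:
  "(norm f)\<^sup>2 \<le> b \<longleftrightarrow> (\<forall>F. finite F \<longrightarrow> (\<Sum>x\<in>F. (cmod (l2_apply f x))\<^sup>2) \<le> b)"
proof -
  let ?q = "\<lambda>x. (cmod (l2_apply f x))\<^sup>2"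
  have int: "integrable (count_space UNIV) ?q"
    using l2_apply by blast
  have norm: "(norm f)\<^sup>2 = integral\<^sup>L (count_space UNIV) ?q"
    by (simp add: norm_l2.rep_eq integral_nonneg)
  have abs: "Infinite_Set_Sum.abs_summable_on ?q UNIV"
    using int by (simp add: Infinite_Set_Sum.abs_summable_on_def)
  then have "?q summable_on UNIV"
    by (simp flip: abs_summable_equivalent)
  then have "sum ?q F \<le> (norm f)\<^sup>2" if "finite F" for F
    using finite_sum_le_infsum[of ?q UNIV F] that infsetsum_infsum[OF abs]
    by (simp add: norm infsetsum_def)
  moreover have "(norm f)\<^sup>2 \<le> b" if "\<And>F. finite F \<Longrightarrow> sum ?q F \<le> b"
    unfolding norm by (rule integrable_count_space_if_finite_sums_le) (use that in auto)
  ultimately show ?thesis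
    by (meson order_trans)
qed

section \<open>Compactness of weighted ellipsoids\<close>

text \<open>Quantifying over finite sets keeps every defining condition a closed condition in the product
  topology.\<close>

definition ellipsoid :: "('a \<Rightarrow> real) \<Rightarrow> real \<Rightarrow> ('a \<Rightarrow> complex) set" where
  "ellipsoid w r = {f. \<forall>F. finite F \<longrightarrow> (\<Sum>x\<in>F. w x * (cmod (f x))\<^sup>2) \<le> r}"

text \<open>An ellipsoid is contained in the product of the discs of radius \<open>sqrt (r / w x)\<close>, as the
  one-point sums show.\<close>

lemma compact_ellipsoid:
  assumes w: "\<And>x. 0 < w x"
  shows "compact (ellipsoid w r)"
proof -
  have "compactin (product_topology (\<lambda>_. euclidean) UNIV)
      (PiE UNIV (\<lambda>x. cball (0 :: complex) (sqrt (r / w x))))"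
    by (simp add: compactin_PiE)
  then have box: "compact (PiE UNIV (\<lambda>x. cball (0 :: complex) (sqrt (r / w x))))"
    by (simp add: euclidean_product_topology)
  have "closed {f. (\<Sum>x\<in>F. w x * (cmod (f x))\<^sup>2) \<le> r}" for F
    by (intro closed_Collect_le continuous_intros continuous_on_product_coordinates)
  then have closed: "closed (ellipsoid w r)"
    unfolding ellipsoid_def by (intro closed_Collect_all closed_Collect_imp) auto
  have "ellipsoid w r \<subseteq> PiE UNIV (\<lambda>x. cball 0 (sqrt (r / w x)))"
  proof
    fix f
    assume f: "f \<in> ellipsoid w r"
    have "cmod (f x) \<le> sqrt (r / w x)" for x
    proof (rule real_le_rsqrt)
      have "w x * (cmod (f x))\<^sup>2 \<le> r"
        using f[unfolded ellipsoid_def, simplified, rule_format, of "{x}"] by simp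
      then show "(cmod (f x))\<^sup>2 \<le> r / w x"
        using w[of x] by (simp add: field_simps)
    qed
    then show "f \<in> PiE UNIV (\<lambda>x. cball 0 (sqrt (r / w x)))"
      by auto
  qed
  with compact_Int_closed[OF box closed] show ?thesis
    by (simp add: Int_absorb1)
qed

text \<open>The tail estimate: off \<open>{x. w x \<le> c}\<close> each term is at most
  \<open>w x / c\<close> times itself, and
  \<open>|f x - g x|\<^sup>2 \<le> 2 |f x|\<^sup>2 + 2 |g x|\<^sup>2\<close>.\<close>

lemma sum_norm_square_diff_le:
  assumes w: "\<And>x. 0 < w x" and fin: "finite {x. w x \<le> c}" and c: "0 < c"
    and f: "f \<in> ellipsoid w r" and g: "g \<in> ellipsoid w r" and F: "finite F"
  shows "(\<Sum>x\<in>F. (cmod (f x - g x))\<^sup>2)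
    \<le> (\<Sum>x | w x \<le> c. (cmod (f x - g x))\<^sup>2) + 4 * r / c"
proof -
  let ?d = "\<lambda>x. (cmod (f x - g x))\<^sup>2"
  let ?L = "{x. w x \<le> c}"
  have tail: "?d x \<le> 2 / c * (w x * (cmod (f x))\<^sup>2) + 2 / c * (w x * (cmod (g x))\<^sup>2)"
    if "x \<in> F - ?L" for x
  proof -
    have "?d x \<le> 2 * (cmod (f x))\<^sup>2 + 2 * (cmod (g x))\<^sup>2"
      using norm_square_add_le[of "1/2" "f x" "- g x"] by simp
    also have "\<dots> = 1 * (2 * (cmod (f x))\<^sup>2 + 2 * (cmod (g x))\<^sup>2)"
      by simp
    also have "\<dots> \<le> w x / c * (2 * (cmod (f x))\<^sup>2 + 2 * (cmod (g x))\<^sup>2)"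
      using that c by (intro mult_right_mono) auto
    finally show ?thesis
      by (simp add: algebra_simps)
  qed
  have "sum ?d F = sum ?d (F \<inter> ?L) + sum ?d (F - ?L)"
    using F by (subst sum.union_disjoint[symmetric]) (auto intro: sum.cong)
  moreover have "sum ?d (F \<inter> ?L) \<le> sum ?d ?L"
    by (rule sum_mono2) (use fin in auto)
  moreover have "sum ?d (F - ?L)
    \<le> 2 / c * (\<Sum>x\<in>F - ?L. w x * (cmod (f x))\<^sup>2) + 2 / c * (\<Sum>x\<in>F - ?L. w x * (cmod (g x))\<^sup>2)"
    unfolding sum_distrib_left sum.distrib[symmetric] by (rule sum_mono) (rule tail)
  moreover have "2 / c * (\<Sum>x\<in>F - ?L. w x * (cmod (h x))\<^sup>2) \<le> 2 / c * r"
    if "h \<in> ellipsoid w r" for h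
    using that F c by (intro mult_left_mono) (auto simp: ellipsoid_def)
  from this[OF f] this[OF g] have
    "2 / c * (\<Sum>x\<in>F - ?L. w x * (cmod (f x))\<^sup>2) + 2 / c * (\<Sum>x\<in>F - ?L. w x * (cmod (g x))\<^sup>2)
      \<le> 4 * r / c"
    by simp
  ultimately show ?thesis
    by linarith
qed

lemma zero_in_ellipsoid_iff: "(\<lambda>_. 0) \<in> ellipsoid w r \<longleftrightarrow> 0 \<le> r"
  by (auto simp: ellipsoid_def)

lemma ellipsoid_square_integrable:
  assumes w: "\<And>x. 0 < w x" and fin: "\<And>c. finite {x. w x \<le> c}" and f: "f \<in> ellipsoid w r"
  shows "integrable (count_space UNIV) (\<lambda>x. (cmod (f x))\<^sup>2)"
proof (rule integrable_count_space_if_finite_sums_le)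
  have r: "0 \<le> r"
    using f[unfolded ellipsoid_def, simplified, rule_format, of "{}"] by simp
  \<comment> \<open>The tail estimate for the difference from the centre of the ellipsoid bounds all finite sums.\<close>
  show "(\<Sum>x\<in>F. (cmod (f x))\<^sup>2) \<le> (\<Sum>x | w x \<le> 1. (cmod (f x))\<^sup>2) + 4 * r / 1" if "finite F" for F
    using sum_norm_square_diff_le[OF w fin zero_less_one f zero_in_ellipsoid_iff[THEN iffD2, OF r] that]
    by simp
qed simp

text \<open>On an ellipsoid the product topology is at least as fine as the norm topology: a small norm
  distance needs closeness at the finitely many coordinates with \<open>w x \<le> c\<close> only, once
  \<open>c\<close> is large.\<close>

lemma continuous_on_ellipsoid_Abs_l2:
  assumes w: "\<And>x. 0 < w x" and fin: "\<And>c. finite {x. w x \<le> c}"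
  shows "continuous_on (ellipsoid w r) Abs_l2"
  unfolding continuous_on_def
proof (intro ballI tendstoI)
  fix g :: "'a \<Rightarrow> complex" and e :: real
  assume g: "g \<in> ellipsoid w r" and e: "0 < e"
  have r: "0 \<le> r"
    using g[unfolded ellipsoid_def, simplified, rule_format, of "{}"] by simp
  \<comment> \<open>The constant makes the tail \<open>4 * r / c\<close> smaller than half of \<open>e\<^sup>2\<close>, also for \<open>r = 0\<close>.\<close>
  define c where "c = (8 * r + 1) / e\<^sup>2"
  have c: "0 < c" "4 * r / c < e\<^sup>2 / 2"
    using r e by (auto simp: c_def field_simps)
  let ?L = "{x. w x \<le> c}"
  have "continuous_on UNIV (\<lambda>f :: 'a \<Rightarrow> complex. \<Sum>x\<in>?L. (cmod (f x - g x))\<^sup>2)"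
    by (intro continuous_intros continuous_on_product_coordinates)
  then have "((\<lambda>f. \<Sum>x\<in>?L. (cmod (f x - g x))\<^sup>2) \<longlongrightarrow> (\<Sum>x\<in>?L. (cmod (g x - g x))\<^sup>2))
      (at g within ellipsoid w r)"
    unfolding continuous_on_def by (blast intro: tendsto_within_subset)
  then have "\<forall>\<^sub>F f in at g within ellipsoid w r. (\<Sum>x\<in>?L. (cmod (f x - g x))\<^sup>2) < e\<^sup>2 / 2"
    by (rule order_tendstoD) (use e in simp)
  moreover have "\<forall>\<^sub>F f in at g within ellipsoid w r. f \<in> ellipsoid w r"
    by (simp add: eventually_at_filter)
  ultimately show "\<forall>\<^sub>F f in at g within ellipsoid w r. dist (Abs_l2 f) (Abs_l2 g) < e"
  proof eventually_elim
    case (elim f)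
    have "(norm (Abs_l2 f - Abs_l2 g))\<^sup>2 \<le> (\<Sum>x\<in>?L. (cmod (f x - g x))\<^sup>2) + 4 * r / c"
      unfolding norm_l2_square_le_iff
      using sum_norm_square_diff_le[OF w fin c(1) elim(2) g]
        ellipsoid_square_integrable[OF w fin elim(2)] ellipsoid_square_integrable[OF w fin g]
      by (simp add: minus_l2.rep_eq Abs_l2_inverse)
    also have "\<dots> < e\<^sup>2"
      using elim(1) c(2) by simp
    finally show ?case
      using e by (simp add: dist_l2_def power2_less_imp_less)
  qed
qed

lemma compact_l2_ellipsoid:
  assumes w: "\<And>x. 0 < w x" and fin: "\<And>c. finite {x. w x \<le> c}"
  shows "compact {f. l2_apply f \<in> ellipsoid w r}"
proof -
  have "{f. l2_apply f \<in> ellipsoid w r} = Abs_l2 ` ellipsoid w r"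
  proof (intro equalityI subsetI)
    fix f
    assume "f \<in> {f. l2_apply f \<in> ellipsoid w r}"
    then show "f \<in> Abs_l2 ` ellipsoid w r"
      by (metis (mono_tags) image_eqI l2_apply_inverse mem_Collect_eq)
  qed (auto simp: Abs_l2_inverse ellipsoid_square_integrable[OF w fin])
  then show ?thesis
    using compact_continuous_image[OF continuous_on_ellipsoid_Abs_l2[OF w fin] compact_ellipsoid[OF w]]
    by simp
qed

section \<open>The multiplier\<close>

text \<open>The weighted square of a value of the image is exactly the square of the original value.\<close>

lemma multiplier_operator_in_ellipsoid:
  assumes "norm f \<le> R"
  shows "l2_apply (multiplier_operator \<gamma> f) \<in> ellipsoid (\<lambda>x. 1 + (\<gamma> x)\<^sup>2) (R\<^sup>2)"
proof -
  have pos: "0 < 1 + (\<gamma> x)\<^sup>2" for x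
    by (simp add: add_pos_nonneg)
  have "(1 + (\<gamma> x)\<^sup>2) * (cmod (l2_apply (multiplier_operator \<gamma> f) x))\<^sup>2 = (cmod (l2_apply f x))\<^sup>2" for x
    using pos[of x] by (simp add: multiplier_operator.rep_eq norm_divide power_divide)
  moreover have "(norm f)\<^sup>2 \<le> R\<^sup>2"
    using assms by (simp add: power_mono)
  ultimately show ?thesis
    by (simp add: ellipsoid_def norm_l2_square_le_iff)
qed

lemma bounded_linear_multiplier_operator: "bounded_linear (multiplier_operator \<gamma>)"
proof (rule bounded_linear_intro[where K = 1])
  show "multiplier_operator \<gamma> (f + g) = multiplier_operator \<gamma> f + multiplier_operator \<gamma> g" for f g
    by transfer (simp add: add_divide_distrib)
  show "multiplier_operator \<gamma> (s *\<^sub>R f) = s *\<^sub>R multiplier_operator \<gamma> f" for s f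
    by transfer simp
  show "norm (multiplier_operator \<gamma> f) \<le> norm f * 1" for f
  proof -
    have le: "(cmod (l2_apply (multiplier_operator \<gamma> f) x))\<^sup>2
        \<le> (1 + (\<gamma> x)\<^sup>2) * (cmod (l2_apply (multiplier_operator \<gamma> f) x))\<^sup>2" for x
      by (simp add: algebra_simps)
    have "(\<Sum>x\<in>F. (cmod (l2_apply (multiplier_operator \<gamma> f) x))\<^sup>2) \<le> (norm f)\<^sup>2"
      if "finite F" for F
    proof (rule order_trans[OF sum_mono[OF le]])
      show "(\<Sum>x\<in>F. (1 + (\<gamma> x)\<^sup>2) * (cmod (l2_apply (multiplier_operator \<gamma> f) x))\<^sup>2)
          \<le> (norm f)\<^sup>2"
        using multiplier_operator_in_ellipsoid[OF order_refl[of "norm f"], of \<gamma>] that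
        unfolding ellipsoid_def by blast
    qed
    then have "(norm (multiplier_operator \<gamma> f))\<^sup>2 \<le> (norm f)\<^sup>2"
      unfolding norm_l2_square_le_iff by blast
    then have "norm (multiplier_operator \<gamma> f) \<le> norm f"
      by (rule power2_le_imp_le) simp
    then show ?thesis
      by simp
  qed
qed

lemma compact_operator_multiplier_operator:
  assumes fin: "\<And>d. finite {x. \<bar>\<gamma> x\<bar> \<le> d}"
  shows "compact_operator (multiplier_operator \<gamma>)"
  unfolding compact_operator_def
proof (intro conjI allI impI)
  show "bounded_linear (multiplier_operator \<gamma>)"
    by (rule bounded_linear_multiplier_operator)
  show "multiplier_operator \<gamma> (scaleC_l2 a f) = scaleC_l2 a (multiplier_operator \<gamma> f)" for a f
    by transfer simp
  fix S :: "'a l2 set"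
  assume "bounded S"
  then obtain R where R: "\<And>f. f \<in> S \<Longrightarrow> norm f \<le> R"
    by (auto simp: bounded_iff)
  let ?w = "\<lambda>x. 1 + (\<gamma> x)\<^sup>2"
  let ?K = "{f. l2_apply f \<in> ellipsoid ?w (R\<^sup>2)}"
  have "finite {x. ?w x \<le> c}" for c
  proof (rule finite_subset)
    show "{x. ?w x \<le> c} \<subseteq> {x. \<bar>\<gamma> x\<bar> \<le> sqrt c}"
      by (auto intro!: real_le_rsqrt)
  qed (rule fin)
  then have K: "compact ?K"
    by (intro compact_l2_ellipsoid) (auto simp: add_pos_nonneg)
  have "multiplier_operator \<gamma> ` S \<subseteq> ?K"
    using R multiplier_operator_in_ellipsoid by auto
  then have "closure (multiplier_operator \<gamma> ` S) \<subseteq> ?K"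
    by (rule closure_minimal) (rule compact_imp_closed[OF K])
  then show "compact (closure (multiplier_operator \<gamma> ` S))"
    using compact_Int_closed[OF K closed_closure] by (metis inf.absorb2)
qed

theorem theorem4p10:
  fixes p :: "'a :: {topological_ab_group_add, t2_space} dual \<Rightarrow> 'a dual \<Rightarrow> real"
    and \<gamma> :: "'a dual \<Rightarrow> real"
  defines "\<gamma> \<equiv> \<lambda>\<xi>. p \<xi> 1"
  assumes "compact (UNIV :: 'a set)"
    and "pseudometric p"
    and "translation_invariant p"
    and "continuous_on UNIV (\<lambda>(\<xi>, \<eta>). p \<xi> \<eta>)"
    and "\<And>d. d > 0 \<Longrightarrow> finite {\<xi>. \<gamma> \<xi> \<le> d}"
  shows "compact_operator (multiplier_operator \<gamma>)"
proof (rule compact_operator_multiplier_operator)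
  fix d
  show "finite {\<xi>. \<bar>\<gamma> \<xi>\<bar> \<le> d}"
  proof (rule finite_subset)
    \<comment> \<open>The maximum supplies a positive level when \<open>d\<close> is not positive.\<close>
    show "{\<xi>. \<bar>\<gamma> \<xi>\<bar> \<le> d} \<subseteq> {\<xi>. \<gamma> \<xi> \<le> max d 1}"
      by auto
    show "finite {\<xi>. \<gamma> \<xi> \<le> max d 1}"
      by (rule assms(6)) simp
  qed
qed

end
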